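(* Let $\mathbf x_1,\dots,\mathbf x_n\in\mathbb R^d$, let $1\le K\le n$, and let $H=(V,E_H)$ and $H'=(V,E_{H'})$ be finite simple undirected graphs on $V=[n]$ with $E_H\subseteq E_{H'}$. Then, with the notation of the context, $$\mathcal C(H)\subseteq\mathcal C(H'),\qquad \mathcal A_H(S,k)\subseteq\mathcal A_{H'}(S,k)\ \text{ for all nonempty }S\subseteq V,\ 1\le k\le|S|,$$ $$\mathcal R_{H,K}\subseteq\mathcal R_{H',K},\qquad \mathcal F(H)\subseteq\mathcal F(H').$$ Hence, for every $s$, $$C_s(H)\le C_s(H'),\qquad T_K^{\mathrm{reach}}(H)\le T_K^{\mathrm{reach}}(H'),\qquad \mathrm{OPT}(H,K)\ge\mathrm{OPT}(H',K).$$ Moreover, if $\mathcal F(H)$ contains an unrestricted optimum (a partition of $V$ into exactly $K$ nonempty blocks minimizing $\sum_{A\in\ell}\phi_{\mathrm{SSE}}(A)$ over all such partitions), then so does $\mathcal F(H')$.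
   Context: $V=[n]$ indexes the observations. For nonempty $A\subseteq V$, $\phi_{\mathrm{SSE}}(A)=\sum_{i\in A}\|\mathbf x_i-\boldsymbol\mu(A)\|^2$ with $\boldsymbol\mu(A)=|A|^{-1}\sum_{i\in A}\mathbf x_i$. Convention: $\min\emptyset=+\infty$. For a graph $H$ on $V$: - $\mathcal C(H)=\{A\subseteq V:A\ne\emptyset,\ H[A]\text{ connected}\}$; $C_s(H)=|\{B\in\mathcal C(H):|B|=s\}|$. - $\mathcal F(H)$ is the set of partitions of $V$ all of whose blocks belong to $\mathcal C(H)$. - $\mathrm{OPT}(H,K)$ is the minimum of $\sum_{A\in\ell}\phi_{\mathrm{SSE}}(A)$ over $\ell\in\mathcal F(H)$ with exactly $K$ blocks. - $\mathcal A_H(S,k)=\{B\in\mathcal C(H):B\subseteq S,\ \min S\in B,\ |B|\le|S|-k+1\}$ for $\emptyset\neq S\subseteq V$, $1\le k\le|S|$. - $\mathcal R_{H,K}$ is the smallest set of pairs containing $(V,K)$ such that whenever $(S,k)\in\mathcal R_{H,K}$, $k\ge2$ and $B\in\mathcal A_H(S,k)$, also $(S\setminus B,k-1)\in\mathcal R_{H,K}$. - $\displaystyle T_K^{\mathrm{reach}}(H)=\sum_{(S,k)\in\mathcal R_{H,K},\,k\ge2}|\mathcal A_H(S,k)|+\sum_{(S,1)\in\mathcal R_{H,K}}\mathbf 1\{S\in\mathcal C(H)\}$. *)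

theory Defs
  imports
    "HOL-Analysis.Analysis"
    "HOL-Library.Disjoint_Sets"
    "Graph_Theory.Digraph_Component"
begin

definition centroid :: "(nat \<Rightarrow> real ^ 'd) \<Rightarrow> nat set \<Rightarrow> real ^ 'd" where
  "centroid x A = (1 / real (card A)) *\<^sub>R (\<Sum>i\<in>A. x i)"

definition sse :: "(nat \<Rightarrow> real ^ 'd) \<Rightarrow> nat set \<Rightarrow> real" where
  "sse x A = (\<Sum>i\<in>A. (norm (x i - centroid x A))\<^sup>2)"

definition partition_cost :: "(nat \<Rightarrow> real ^ 'd) \<Rightarrow> nat set set \<Rightarrow> real" where
  "partition_cost x P = (\<Sum>A\<in>P. sse x A)"

(* A finite simple undirected graph is a pair_graph (finite, loop-free, symmetric arc relation).
   The qualified constant is graph connectivity; the unqualified one may be the topological notion. *)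
definition conn_sets :: "nat pair_pre_digraph \<Rightarrow> nat set set" where
  "conn_sets H =
     {A. A \<subseteq> pverts H \<and> A \<noteq> {} \<and> Digraph_Component.connected (induce_subgraph (with_proj H) A)}"

definition num_conn_sets :: "nat pair_pre_digraph \<Rightarrow> nat \<Rightarrow> nat" where
  "num_conn_sets H s = card {B \<in> conn_sets H. card B = s}"

definition conn_partitions :: "nat pair_pre_digraph \<Rightarrow> nat set set set" where
  "conn_partitions H = {P. partition_on (pverts H) P \<and> (\<forall>A\<in>P. A \<in> conn_sets H)}"

definition opt :: "(nat \<Rightarrow> real ^ 'd) \<Rightarrow> nat pair_pre_digraph \<Rightarrow> nat \<Rightarrow> ereal" where
  "opt x H K =
     (let F = {P \<in> conn_partitions H. card P = K}
      in if F = {} then \<infinity> else ereal (Min (partition_cost x ` F)))"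

definition unrestricted_optimum ::
  "(nat \<Rightarrow> real ^ 'd) \<Rightarrow> nat set \<Rightarrow> nat \<Rightarrow> nat set set \<Rightarrow> bool" where
  "unrestricted_optimum x V K =
     is_arg_min (partition_cost x) (\<lambda>P. partition_on V P \<and> card P = K)"

(* Meant for nonempty S \<subseteq> pverts H and 1 \<le> k \<le> card S, where the subtraction does not truncate.
   All pairs in reach H K are of this form when 1 \<le> K \<le> card (pverts H). *)
definition admissible :: "nat pair_pre_digraph \<Rightarrow> nat set \<Rightarrow> nat \<Rightarrow> nat set set" where
  "admissible H S k =
     {B \<in> conn_sets H. B \<subseteq> S \<and> Min S \<in> B \<and> card B \<le> card S - k + 1}"

inductive_set reach :: "nat pair_pre_digraph \<Rightarrow> nat \<Rightarrow> (nat set \<times> nat) set"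
  for H :: "nat pair_pre_digraph" and K :: nat
where
  init: "(pverts H, K) \<in> reach H K"
| step: "(S, k) \<in> reach H K \<Longrightarrow> k \<ge> 2 \<Longrightarrow> B \<in> admissible H S k \<Longrightarrow> (S - B, k - 1) \<in> reach H K"

definition T_reach :: "nat pair_pre_digraph \<Rightarrow> nat \<Rightarrow> nat" where
  "T_reach H K =
     (\<Sum>(S, k)\<in>{(S, k). (S, k) \<in> reach H K \<and> k \<ge> 2}. card (admissible H S k)) +
     (\<Sum>S\<in>{S. (S, 1) \<in> reach H K}. of_bool (S \<in> conn_sets H))"

end

theory Submission
  imports Defs
begin

text \<open>Adding edges on a fixed vertex set keeps every walk, so a connected induced subgraph
  stays connected (\<open>conn_sets_mono\<close>). The graph enters every other notion only through
  its vertex set and \<open>conn_sets\<close>, and monotonically: admissible blocks, reachable pairs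
  and feasible partitions are inherited. Counts and sums of nonnegative terms then grow by
  finiteness (\<open>T_reach_mono\<close>), and a minimum over a larger family can only drop
  (\<open>opt_antimono\<close>).\<close>

lemma conn_sets_mono:
  assumes "pverts H = pverts H'" and "parcs H \<subseteq> parcs H'"
  shows "conn_sets H \<subseteq> conn_sets H'"
proof
  fix A assume A: "A \<in> conn_sets H"
  \<comment> \<open>\<open>connected\<close> means strong connectivity of the symmetric closure, so
    the arcs are compared there.\<close>
  let ?M = "\<lambda>G. mk_symmetric (induce_subgraph (with_proj G) A)"
  have "parcs (?M H) \<subseteq> parcs (?M H')"
    using assms(2) by (auto simp: mk_symmetric_def)
  \<comment> \<open>Reachability is \<open>rtrancl_on\<close> over the vertex set, which is
    \<open>A\<close> on both sides; only the arc relation grows.\<close>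
  then have "u \<rightarrow>\<^sup>*\<^bsub>with_proj (?M H')\<^esub> v"
    if "u \<rightarrow>\<^sup>*\<^bsub>with_proj (?M H)\<^esub> v" for u v
    using that unfolding reachable_def
    by (simp add: mk_symmetric_def) (blast intro: rtrancl_on_mono)
  then show "A \<in> conn_sets H'"
    using A assms(1)
    by (auto simp: conn_sets_def Digraph_Component.connected_def strongly_connected_def
        mk_symmetric_def)
qed

lemma finite_conn_sets: "finite (pverts H) \<Longrightarrow> finite (conn_sets H)"
  by (rule finite_subset[of _ "Pow (pverts H)"]) (auto simp: conn_sets_def)

lemma num_conn_sets_mono:
  assumes "finite (pverts H')" and "conn_sets H \<subseteq> conn_sets H'"
  shows "num_conn_sets H s \<le> num_conn_sets H' s"
  unfolding num_conn_sets_def using assms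
  by (intro card_mono) (auto simp: finite_conn_sets)

lemma admissible_mono:
  "conn_sets H \<subseteq> conn_sets H' \<Longrightarrow> admissible H S k \<subseteq> admissible H' S k"
  by (auto simp: admissible_def)

lemma finite_admissible: "finite (pverts H) \<Longrightarrow> finite (admissible H S k)"
  by (simp add: admissible_def finite_conn_sets)

text \<open>The successor \<open>(S - B, k - 1)\<close> does not mention the graph, so each
  derivation for \<open>H\<close> can be replayed in \<open>H'\<close> with the same blocks.\<close>

lemma reach_mono:
  assumes "pverts H = pverts H'" and "conn_sets H \<subseteq> conn_sets H'"
  shows "reach H K \<subseteq> reach H' K"
proof (rule subrelI)
  fix S k assume "(S, k) \<in> reach H K"
  then show "(S, k) \<in> reach H' K"
  proof induction
    case init
    show ?case using assms(1) by (simp add: reach.init)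
  next
    case (step S k B)
    then show ?case using admissible_mono[OF assms(2)] by (blast intro: reach.step)
  qed
qed

text \<open>Steps only shrink both components; this confines \<open>reach\<close> to a finite box,
  as needed because sums over infinite sets default to 0.\<close>

lemma reach_bounds: "(S, k) \<in> reach H K \<Longrightarrow> S \<subseteq> pverts H \<and> k \<le> K"
  by (induction rule: reach.induct) auto

lemma finite_reach:
  assumes "finite (pverts H)"
  shows "finite (reach H K)"
  by (rule finite_subset[of _ "Pow (pverts H) \<times> {..K}"]) (use assms reach_bounds in fastforce)+

text \<open>Each of the two sums is compared through a mixed one: summands of \<open>H'\<close> over
  the index set of \<open>H\<close>.\<close>

lemma T_reach_mono:
  assumes "finite (pverts H')" and "pverts H = pverts H'" and C: "conn_sets H \<subseteq> conn_sets H'"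
  shows "T_reach H K \<le> T_reach H' K"
proof -
  note R = reach_mono[OF assms(2) C, of K]
  note fin = finite_reach[OF assms(1), of K]
  have "(\<Sum>(S, k)\<in>{(S, k). (S, k) \<in> reach H K \<and> k \<ge> 2}. card (admissible H S k))
      \<le> (\<Sum>(S, k)\<in>{(S, k). (S, k) \<in> reach H K \<and> k \<ge> 2}. card (admissible H' S k))"
    by (intro sum_mono)
      (auto intro!: card_mono finite_admissible admissible_mono[OF C, THEN subsetD] assms(1))
  also have "\<dots> \<le> (\<Sum>(S, k)\<in>{(S, k). (S, k) \<in> reach H' K \<and> k \<ge> 2}. card (admissible H' S k))"
    by (intro sum_mono2 finite_subset[OF _ fin]) (use R in auto)
  finally have 1: "(\<Sum>(S, k)\<in>{(S, k). (S, k) \<in> reach H K \<and> k \<ge> 2}. card (admissible H S k))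
      \<le> (\<Sum>(S, k)\<in>{(S, k). (S, k) \<in> reach H' K \<and> k \<ge> 2}. card (admissible H' S k))" .
  have "finite {S. (S, 1) \<in> reach H' K}"
    by (rule finite_subset[OF _ finite_imageI[OF fin, of fst]]) force
  then have "(\<Sum>S\<in>{S. (S, 1) \<in> reach H K}. of_bool (S \<in> conn_sets H') :: nat)
      \<le> (\<Sum>S\<in>{S. (S, 1) \<in> reach H' K}. of_bool (S \<in> conn_sets H'))"
    by (intro sum_mono2) (use R in auto)
  moreover have "(\<Sum>S\<in>{S. (S, 1) \<in> reach H K}. of_bool (S \<in> conn_sets H) :: nat)
      \<le> (\<Sum>S\<in>{S. (S, 1) \<in> reach H K}. of_bool (S \<in> conn_sets H'))"
    by (intro sum_mono) (use C in auto)
  ultimately show ?thesis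
    unfolding T_reach_def using 1 by (meson add_mono order_trans)
qed

lemma conn_partitions_mono:
  "pverts H = pverts H' \<Longrightarrow> conn_sets H \<subseteq> conn_sets H' \<Longrightarrow> conn_partitions H \<subseteq> conn_partitions H'"
  by (auto simp: conn_partitions_def)

lemma finite_conn_partitions: "finite (pverts H) \<Longrightarrow> finite (conn_partitions H)"
  by (rule finite_subset[OF _ finitely_many_partition_on]) (auto simp: conn_partitions_def)

lemma opt_antimono:
  assumes "finite (pverts H')" and "conn_partitions H \<subseteq> conn_partitions H'"
  shows "opt x H' K \<le> opt x H K"
proof (cases "{P \<in> conn_partitions H. card P = K} = {}")
  \<comment> \<open>With no feasible partition for \<open>H\<close>, the right-hand side is
    infinite.\<close>
  case True
  then show ?thesis by (simp add: opt_def)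
next
  case False
  have sub: "{P \<in> conn_partitions H. card P = K} \<subseteq> {P \<in> conn_partitions H'. card P = K}"
    using assms(2) by auto
  have "Min (partition_cost x ` {P \<in> conn_partitions H'. card P = K})
      \<le> Min (partition_cost x ` {P \<in> conn_partitions H. card P = K})"
    using False by (intro Min_antimono image_mono sub) (auto simp: finite_conn_partitions assms(1))
  \<comment> \<open>This puts \<open>opt x H' K\<close> in its finite branch too.\<close>
  moreover have "{P \<in> conn_partitions H'. card P = K} \<noteq> {}"
    using False sub by blast
  ultimately show ?thesis
    unfolding opt_def Let_def using False by (simp only: if_False ereal_less_eq(3))
qed

theorem proposition2:
  fixes n K :: nat
    and x :: "nat \<Rightarrow> real ^ 'd"
    and H H' :: "nat pair_pre_digraph"
  assumes "1 \<le> K" and "K \<le> n"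
    and "pair_graph H" and "pverts H = {1..n}"
    and "pair_graph H'" and "pverts H' = {1..n}"
    and "parcs H \<subseteq> parcs H'"
  shows "conn_sets H \<subseteq> conn_sets H' \<and>
    (\<forall>S k. S \<noteq> {} \<and> S \<subseteq> {1..n} \<and> 1 \<le> k \<and> k \<le> card S \<longrightarrow>
       admissible H S k \<subseteq> admissible H' S k) \<and>
    reach H K \<subseteq> reach H' K \<and>
    conn_partitions H \<subseteq> conn_partitions H' \<and>
    (\<forall>s. num_conn_sets H s \<le> num_conn_sets H' s) \<and>
    T_reach H K \<le> T_reach H' K \<and>
    opt x H K \<ge> opt x H' K \<and>
    ((\<exists>P \<in> conn_partitions H. unrestricted_optimum x {1..n} K P) \<longrightarrow>
     (\<exists>P \<in> conn_partitions H'. unrestricted_optimum x {1..n} K P))"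
proof -
  have V: "pverts H = pverts H'" and fin: "finite (pverts H')"
    using assms by auto
  have C: "conn_sets H \<subseteq> conn_sets H'"
    using conn_sets_mono[OF V] assms by blast
  note F = conn_partitions_mono[OF V C]
  show ?thesis
    \<comment> \<open>\<open>unrestricted_optimum\<close> does not depend on the graph, so the same
      partition is the witness for \<open>H'\<close>.\<close>
    using C admissible_mono[OF C] reach_mono[OF V C] F num_conn_sets_mono[OF fin C]
      T_reach_mono[OF fin V C] opt_antimono[OF fin F]
    by blast
qed

end
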